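(* There exist a constant $c>0$ and, for all sufficiently large $n\in\mathcal S'$ satisfying $\alpha_1=\dots=\alpha_{\omega(n)}=1$ in its prime decomposition, a real number $\tilde\tau_n$ with $$1\le\tilde\tau_n\le c\,\mathcal N_n^{\log(\log(\log(n)))}$$ such that $|s_n(\tilde\tau_n)-1|\to0$ as $n\to\infty$ along these integers.
   Context: $\mathcal S=\{a^2+b^2:(a,b)\in\mathbb Z^2\}$, $\Lambda_n=\{\lambda\in\mathbb Z^2:\lambda_1^2+\lambda_2^2=n\}$, $\mathcal N_n=\operatorname{card}\Lambda_n$. For $n\in\mathcal S$ write $n=2^{\alpha}\prod_{j=1}^{k}p_j^{\alpha_j}\prod_{j=1}^{l}q_j^{2\beta_j}$ with $p_j\equiv1$ and $q_j\equiv3\pmod 4$ distinct primes; then $\mathcal N_n=4\prod_{j=1}^k(1+\alpha_j)$. Set $\omega(n)=k$; when all $\alpha_j=1$, $\mathcal N_n=2^{\omega(n)+2}$. For each $j$, $\mathcal P_j\in\mathbb Z[i]$ is a Gaussian prime with $\mathcal P_j\overline{\mathcal P_j}=p_j$, and $\theta_j=\arg(\mathcal P_j)$. The linearised covariance function is $$s_n(t)=\frac4{\mathcal N_n}\sum_{\eta\in\{-1,1\}^{\omega(n)}}\cos(2\pi\theta_\eta t),\quad t\in\mathbb R,\qquad \theta_\eta=\sum_{j=1}^{\omega(n)}\eta_j\theta_j\pmod 1,$$ where $\theta_\eta$ is taken as the representative in $[0,1)$. Standing assumption: $\mathcal S'\subset\mathcal S$ is a fixed subset of relative density $1$ in $\mathcal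 S$ such that, as $n\to\infty$ in $\mathcal S'$: (a) $\mathcal N_n=\log(n)^{\log(2)/2+o(1)}$, so that for every $0<\kappa'<\log(2)/2$, $\mathcal N_n\ge\log(n)^{\kappa'}$ for $n$ large; (b) the probability measures $\frac1{\mathcal N_n}\sum_{\lambda\in\Lambda_n}\delta_{\lambda/\sqrt n}$ converge weakly to the uniform probability measure $\sigma$ on the unit circle $\mathbb S^1$, and for every $\rho<\frac12\log(\pi/2)$ and $n$ large enough, $\sup_{\Gamma}\left|\frac1{\mathcal N_n}\operatorname{card}\{\lambda\in\Lambda_n:\lambda/\sqrt n\in\Gamma\}-\sigma(\Gamma)\right|\le\log(n)^{-\rho}$, the supremum being over arcs $\Gamma\subset\mathbb S^1$. *)

theory Defs
  imports "HOL-Probability.Probability" "HOL-Computational_Algebra.Computational_Algebra"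
begin

definition sums_two_squares :: "nat set" where
  "sums_two_squares = {n. \<exists>a b :: int. int n = a\<^sup>2 + b\<^sup>2}"

definition lattice_pts :: "nat \<Rightarrow> (int \<times> int) set" where
  "lattice_pts n = {(a, b). a\<^sup>2 + b\<^sup>2 = int n}"

definition num_lattice_pts :: "nat \<Rightarrow> nat" where
  "num_lattice_pts n = card (lattice_pts n)"

definition split_primes :: "nat \<Rightarrow> nat set" where
  "split_primes n = {p \<in> prime_factors n. p mod 4 = 1}"

definition simple_split_part :: "nat \<Rightarrow> bool" where
  "simple_split_part n \<longleftrightarrow> (\<forall>p \<in> split_primes n. multiplicity p n = 1)"

definition gaussian_ints :: "complex set" where
  "gaussian_ints = {z. Re z \<in> \<int> \<and> Im z \<in> \<int>}"

definition gaussian_dvd :: "complex \<Rightarrow> complex \<Rightarrow> bool" where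
  "gaussian_dvd a b \<longleftrightarrow> (\<exists>c \<in> gaussian_ints. b = a * c)"

definition gaussian_prime :: "complex \<Rightarrow> bool" where
  "gaussian_prime z \<longleftrightarrow> z \<in> gaussian_ints \<and> z \<noteq> 0 \<and> \<not> gaussian_dvd z 1 \<and>
     (\<forall>a \<in> gaussian_ints. \<forall>b \<in> gaussian_ints.
        gaussian_dvd z (a * b) \<longrightarrow> gaussian_dvd z a \<or> gaussian_dvd z b)"

text \<open>
  An admissible choice of Gaussian primes: \<open>P n p\<close> is the Gaussian prime chosen above the
  prime \<open>p\<close> in the decomposition of \<open>n\<close>.  It is determined only up to units and
  conjugation, and the choice may depend on \<open>n\<close>.
\<close>

definition gaussian_prime_choice :: "nat set \<Rightarrow> (nat \<Rightarrow> nat \<Rightarrow> complex) \<Rightarrow> bool" where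
  "gaussian_prime_choice S' P \<longleftrightarrow>
     (\<forall>n \<in> S'. \<forall>p \<in> split_primes n. gaussian_prime (P n p) \<and> P n p * cnj (P n p) = of_nat p)"

text \<open>
  Since the angles are added modulo 1, arguments are measured in turns:
  \<open>z = \<bar>z\<bar> exp (2 \<pi> \<i> turn_arg z)\<close>.
\<close>

definition turn_arg :: "complex \<Rightarrow> real" where
  "turn_arg z = Arg z / (2 * pi)"

text \<open>
  The families of signs are indexed by the primes \<open>p\<^sub>j\<close> themselves rather than by \<open>j\<close>;
  \<open>Q p\<close> is the Gaussian prime above \<open>p\<close>.
\<close>

definition signed_angle :: "(nat \<Rightarrow> complex) \<Rightarrow> nat \<Rightarrow> (nat \<Rightarrow> real) \<Rightarrow> real" where
  "signed_angle Q n \<eta> = frac (\<Sum>p \<in> split_primes n. \<eta> p * turn_arg (Q p))"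

definition lin_cov :: "(nat \<Rightarrow> complex) \<Rightarrow> nat \<Rightarrow> real \<Rightarrow> real" where
  "lin_cov Q n t = 4 / real (num_lattice_pts n) *
     (\<Sum>\<eta> \<in> split_primes n \<rightarrow>\<^sub>E {-1, 1}. cos (2 * pi * signed_angle Q n \<eta> * t))"

definition relative_density_one :: "nat set \<Rightarrow> nat set \<Rightarrow> bool" where
  "relative_density_one A B \<longleftrightarrow> A \<subseteq> B \<and>
     (\<lambda>x. real (card (A \<inter> {..x})) / real (card (B \<inter> {..x}))) \<longlonglongrightarrow> 1"

definition at_top_in :: "nat set \<Rightarrow> nat filter" where
  "at_top_in A = inf at_top (principal A)"

text \<open>The plane is identified with the complex numbers.\<close>

definition normalised_pt :: "nat \<Rightarrow> int \<times> int \<Rightarrow> complex" where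
  "normalised_pt n l = Complex (of_int (fst l) / sqrt (real n)) (of_int (snd l) / sqrt (real n))"

definition lattice_measure :: "nat \<Rightarrow> complex measure" where
  "lattice_measure n = distr (uniform_count_measure (lattice_pts n)) borel (normalised_pt n)"

definition circle_measure :: "complex measure" where
  "circle_measure = distr (uniform_measure lborel {0..1}) borel (\<lambda>u::real. cis (2 * pi * u))"

text \<open>
  The library notion of weak convergence is restricted to sequences of measures on the real line.
\<close>

definition weak_limit ::
    "('i \<Rightarrow> 'a::topological_space measure) \<Rightarrow> 'a measure \<Rightarrow> 'i filter \<Rightarrow> bool" where
  "weak_limit \<mu> \<nu> F \<longleftrightarrow>
     (\<forall>f :: 'a \<Rightarrow> real. continuous_on UNIV f \<and> bounded (range f) \<longrightarrow>
        ((\<lambda>n. integral\<^sup>L (\<mu> n) f) \<longlongrightarrow> integral\<^sup>L \<nu> f) F)"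

definition circle_arcs :: "complex set set" where
  "circle_arcs = {\<Gamma>. \<Gamma> \<subseteq> sphere 0 1 \<and> connected \<Gamma>}"

definition arc_discrepancy :: "nat \<Rightarrow> real" where
  "arc_discrepancy n = (SUP \<Gamma> \<in> circle_arcs.
     \<bar>real (card {l \<in> lattice_pts n. normalised_pt n l \<in> \<Gamma>}) / real (num_lattice_pts n)
       - measure circle_measure \<Gamma>\<bar>)"

definition typical_lattice_count :: "nat set \<Rightarrow> bool" where
  "typical_lattice_count A \<longleftrightarrow>
     (\<exists>\<epsilon> :: nat \<Rightarrow> real. (\<epsilon> \<longlongrightarrow> 0) (at_top_in A) \<and>
        (\<forall>\<^sub>F n in at_top_in A. real (num_lattice_pts n) = ln (real n) powr (ln 2 / 2 + \<epsilon> n)))"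

definition equidistributed_lattice_pts :: "nat set \<Rightarrow> bool" where
  "equidistributed_lattice_pts A \<longleftrightarrow>
     weak_limit lattice_measure circle_measure (at_top_in A) \<and>
     (\<forall>\<rho> < ln (pi / 2) / 2.
        \<forall>\<^sub>F n in at_top_in A. arc_discrepancy n \<le> ln (real n) powr (- \<rho>))"

end

theory Submission
  imports Defs "HOL-Number_Theory.Residues" "HOL-Real_Asymp.Real_Asymp"
begin

text \<open>
  At an integer time \<open>t\<close> the reduction of \<open>\<theta>\<^sub>\<eta>\<close> modulo 1 is invisible to \<open>cos (2 \<pi> \<theta>\<^sub>\<eta> t)\<close>, so the
  sum over all families of signs factorises:
  \<open>\<Sum>\<^sub>\<eta> cos (2 \<pi> \<theta>\<^sub>\<eta> t) = 2^k \<Prod>\<^sub>p cos (2 \<pi> t \<theta>\<^sub>p)\<close>, where \<open>k\<close> is the number of primes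
  \<open>p \<equiv> 1 (mod 4)\<close> dividing \<open>n\<close>. If these primes divide \<open>n\<close> exactly once, then
  \<open>\<N>\<^sub>n = 4 \<cdot> 2^k\<close>, the prefactor cancels and the covariance is the product of the \<open>k\<close> cosines
  (\<open>lin_cov_of_int\<close>). It is close to 1 as soon as every \<open>t \<theta>\<^sub>p\<close> is close enough to an integer.

  Dirichlet's simultaneous approximation theorem provides, for each \<open>N\<close>, such a \<open>t\<close> with
  \<open>1 \<le> t \<le> N^k\<close> and all distances below \<open>1 / N\<close>. A cosine is quadratically flat at its
  maximum, so the covariance differs from 1 by at most \<open>2 \<pi>\<^sup>2 k / N\<^sup>2\<close> (\<open>lin_cov_near_1\<close>).
  Write \<open>L = log log n\<close>. The choice \<open>N = \<lfloor>L powr log 2\<rfloor>\<close> serves both bounds. On the one hand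
  \<open>N^k \<le> (L powr log 2)^k = (2^k) powr log L \<le> \<N>\<^sub>n powr log log log n\<close>, so that
  \<open>c = 1\<close> is admissible. On the other hand the typical size of \<open>\<N>\<^sub>n\<close> forces \<open>k \<le> L\<close>
  (\<open>eventually_card_split_primes_le\<close>), and \<open>L / N\<^sup>2\<close> tends to 0 because \<open>2 log 2 > 1\<close>.

  The formula \<open>\<N>\<^sub>n = 4 \<cdot> 2^k\<close> (\<open>num_lattice_pts_simple_split_part\<close>) is obtained by removing the
  prime factors of \<open>n\<close> one at a time. Reading a lattice point as a Gaussian integer of norm \<open>n\<close>,
  a factor 2 corresponds to the map \<open>z \<mapsto> (1 + i) cnj z\<close>, and a prime \<open>q \<equiv> 3 (mod 4)\<close> occurs as
  \<open>q\<^sup>2\<close> and corresponds to multiplication by \<open>q\<close>; both are bijections. A new prime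
  \<open>p = x\<^sup>2 + y\<^sup>2\<close> corresponds to the two multiplications by \<open>x + i y\<close> and \<open>x - i y\<close>, whose images
  are disjoint, and doubles the count.
\<close>

section \<open>Counting representations as a sum of two squares\<close>

lemma finite_lattice_pts: "finite (lattice_pts n)"
proof (rule finite_subset)
  show "lattice_pts n \<subseteq> {- int n..int n} \<times> {- int n..int n}"
  proof
    fix l assume "l \<in> lattice_pts n"
    then obtain a b where l: "l = (a, b)" and eq: "a\<^sup>2 + b\<^sup>2 = int n"
      by (auto simp: lattice_pts_def)
    have bound: "\<bar>x\<bar> \<le> x\<^sup>2" for x :: int
      using self_le_power[of "\<bar>x\<bar>" 2] by (cases "x = 0") auto
    have "\<bar>a\<bar> \<le> int n" "\<bar>b\<bar> \<le> int n"
      using bound[of a] bound[of b] eq zero_le_power2[of a] zero_le_power2[of b] by linarith+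
    thus "l \<in> {- int n..int n} \<times> {- int n..int n}"
      using l by auto
  qed
qed auto

lemma num_lattice_pts_1: "num_lattice_pts 1 = 4"
proof -
  have "lattice_pts 1 = {(1, 0), (-1, 0), (0, 1), (0, -1)}"
  proof (intro equalityI subsetI)
    fix l assume "l \<in> lattice_pts 1"
    then obtain a b where l: "l = (a, b)" and eq: "a\<^sup>2 + b\<^sup>2 = 1"
      by (auto simp: lattice_pts_def)
    have "\<bar>x\<bar> \<le> 1" if "x\<^sup>2 \<le> 1" for x :: int
      using that abs_square_le_1 by blast
    moreover have "a\<^sup>2 \<le> 1" "b\<^sup>2 \<le> 1"
      using eq zero_le_power2[of a] zero_le_power2[of b] by linarith+
    ultimately have "\<bar>a\<bar> \<le> 1" "\<bar>b\<bar> \<le> 1"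
      by auto
    hence "a \<in> {-1, 0, 1}" "b \<in> {-1, 0, 1}"
      by auto
    thus "l \<in> {(1, 0), (-1, 0), (0, 1), (0, -1)}"
      using eq l by auto
  qed (auto simp: lattice_pts_def)
  thus ?thesis
    by (simp add: num_lattice_pts_def)
qed

text \<open>
  The points of norm \<open>2 n\<close> have coordinates of equal parity, so they are the images of the points
  of norm \<open>n\<close> under \<open>z \<mapsto> (1 + i) cnj z\<close>.
\<close>

lemma num_lattice_pts_double: "num_lattice_pts (2 * n) = num_lattice_pts n"
proof -
  have "bij_betw (\<lambda>(a, b). (a + b, a - b)) (lattice_pts n) (lattice_pts (2 * n))"
    unfolding bij_betw_def
  proof (intro conjI equalityI subsetI)
    show "inj_on (\<lambda>(a, b). (a + b, a - b)) (lattice_pts n)"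
      by (auto simp: inj_on_def)
  next
    fix l assume "l \<in> (\<lambda>(a, b). (a + b, a - b)) ` lattice_pts n"
    thus "l \<in> lattice_pts (2 * n)"
      by (auto simp: lattice_pts_def power2_eq_square algebra_simps)
  next
    fix l assume "l \<in> lattice_pts (2 * n)"
    then obtain c d where l: "l = (c, d)" and eq: "c\<^sup>2 + d\<^sup>2 = 2 * int n"
      by (auto simp: lattice_pts_def)
    have "even (c\<^sup>2 + d\<^sup>2)"
      unfolding eq by simp
    hence "even (c + d)"
      by simp
    then obtain a where a: "c + d = 2 * a"
      by blast
    define b where "b = c - a"
    have cd: "c = a + b" "d = a - b"
      using a by (auto simp: b_def)
    have "(a, b) \<in> lattice_pts n"
      using eq by (simp add: lattice_pts_def cd power2_eq_square algebra_simps)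
    thus "l \<in> (\<lambda>(a, b). (a + b, a - b)) ` lattice_pts n"
      using l cd by force
  qed
  thus ?thesis
    by (simp add: num_lattice_pts_def bij_betw_same_card)
qed

text \<open>
  Otherwise neither number is divisible by \<open>q\<close>. Raising \<open>a\<^sup>2 \<equiv> - b\<^sup>2\<close> to the power
  \<open>(q - 1) / 2\<close>, which is odd, then gives \<open>1 \<equiv> -1 (mod q)\<close> by Fermat's little theorem.
\<close>

lemma prime_3_mod_4_dvd_sum_squares:
  fixes a b :: int
  assumes q: "prime q" "q mod 4 = 3" and dvd: "int q dvd a\<^sup>2 + b\<^sup>2"
  shows "int q dvd a"
proof (rule ccontr)
  assume na: "\<not> int q dvd a"
  have pq: "prime (int q)"
    using q by simp
  have nb: "\<not> int q dvd b"
  proof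
    assume "int q dvd b"
    hence "int q dvd b\<^sup>2"
      by (simp add: power2_eq_square)
    hence "int q dvd a\<^sup>2"
      using dvd dvd_add_left_iff by blast
    thus False
      using na pq prime_dvd_power by blast
  qed
  have fermat: "[c ^ (q - 1) = 1] (mod int q)" if "\<not> int q dvd c" for c :: int
  proof -
    have "\<not> q dvd nat \<bar>c\<bar>"
      using that by (metis int_dvd_int_iff dvd_abs_iff abs_ge_zero nat_0_le)
    hence "[nat \<bar>c\<bar> ^ (q - 1) = 1] (mod q)"
      by (intro fermat_theorem q)
    hence "[int (nat \<bar>c\<bar> ^ (q - 1)) = int 1] (mod int q)"
      by (simp only: cong_int_iff)
    hence "[\<bar>c\<bar> ^ (q - 1) = 1] (mod int q)"
      by simp
    moreover have "even (q - 1)"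
      using q by presburger
    ultimately show ?thesis
      by (simp add: power_even_abs)
  qed
  define m where "m = (q - 1) div 2"
  have m: "q - 1 = 2 * m" "odd m"
    using q unfolding m_def by presburger+
  have "[a\<^sup>2 = - (b\<^sup>2)] (mod int q)"
    using dvd by (simp add: cong_iff_dvd_diff)
  hence "[(a\<^sup>2) ^ m = (- (b\<^sup>2)) ^ m] (mod int q)"
    by (rule cong_pow)
  hence "[a ^ (q - 1) = - (b ^ (q - 1))] (mod int q)"
    using m by (simp add: power_mult power_minus_odd)
  moreover have "[- (b ^ (q - 1)) = - 1] (mod int q)"
    using fermat[OF nb] by (simp add: cong_minus_minus_iff)
  ultimately have "[1 = - 1] (mod int q)"
    using fermat[OF na] by (meson cong_sym cong_trans)
  hence "int q dvd 2"
    by (simp add: cong_iff_dvd_diff)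
  hence "q \<le> 2"
    by (auto dest: zdvd_imp_le)
  thus False
    using q by presburger
qed

lemma lattice_pts_3_mod_4:
  assumes q: "prime q" "q mod 4 = 3" and ab: "(a, b) \<in> lattice_pts n" and "q dvd n"
  shows "int q dvd a" "int q dvd b"
proof -
  have "int q dvd a\<^sup>2 + b\<^sup>2" "int q dvd b\<^sup>2 + a\<^sup>2"
    using ab \<open>q dvd n\<close> by (auto simp: lattice_pts_def add.commute)
  thus "int q dvd a" "int q dvd b"
    using prime_3_mod_4_dvd_sum_squares[OF q] by blast+
qed

lemma square_dvd_of_lattice_pts:
  assumes q: "prime q" "q mod 4 = 3" and "lattice_pts n \<noteq> {}" and "q dvd n"
  shows "q\<^sup>2 dvd n"
proof -
  obtain a b where ab: "(a, b) \<in> lattice_pts n"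
    using assms by auto
  have "int q ^ 2 dvd a\<^sup>2 + b\<^sup>2"
    using lattice_pts_3_mod_4[OF q ab \<open>q dvd n\<close>] by (intro dvd_add dvd_power_same)
  hence "int (q ^ 2) dvd int n"
    using ab by (simp add: lattice_pts_def)
  thus ?thesis
    by (simp only: int_dvd_int_iff)
qed

lemma num_lattice_pts_3_mod_4:
  assumes q: "prime q" "q mod 4 = 3"
  shows "num_lattice_pts (q\<^sup>2 * n) = num_lattice_pts n"
proof -
  have q0: "q > 0"
    using q prime_gt_0_nat by blast
  have "bij_betw (\<lambda>(a, b). (int q * a, int q * b)) (lattice_pts n) (lattice_pts (q\<^sup>2 * n))"
    unfolding bij_betw_def
  proof (intro conjI equalityI subsetI)
    show "inj_on (\<lambda>(a, b). (int q * a, int q * b)) (lattice_pts n)"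
      using q0 by (auto simp: inj_on_def)
  next
    fix l assume "l \<in> (\<lambda>(a, b). (int q * a, int q * b)) ` lattice_pts n"
    thus "l \<in> lattice_pts (q\<^sup>2 * n)"
      by (auto simp: lattice_pts_def power_mult_distrib simp flip: distrib_left)
  next
    fix l assume l': "l \<in> lattice_pts (q\<^sup>2 * n)"
    then obtain c d where l: "l = (c, d)"
      by (cases l)
    obtain a b where ab: "c = int q * a" "d = int q * b"
      using lattice_pts_3_mod_4[OF q l'[unfolded l]] by (auto elim!: dvdE simp: power2_eq_square)
    have "(int q)\<^sup>2 * (a\<^sup>2 + b\<^sup>2) = (int q)\<^sup>2 * int n"
      using l' by (simp add: l ab lattice_pts_def algebra_simps)
    hence "(a, b) \<in> lattice_pts n"
      using q0 by (simp add: lattice_pts_def)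
    thus "l \<in> (\<lambda>(a, b). (int q * a, int q * b)) ` lattice_pts n"
      using l ab by force
  qed
  thus ?thesis
    by (simp add: num_lattice_pts_def bij_betw_same_card)
qed

text \<open>
  If the product of \<open>c + i d\<close> with the conjugate of \<open>x + i y\<close> has imaginary part divisible by \<open>p\<close>,
  then its real part is divisible by \<open>p\<close> as well, since its norm is \<open>p\<^sup>2 n\<close>. Hence \<open>x + i y\<close> divides
  \<open>c + i d\<close>, and the quotient \<open>a + i b\<close> has norm \<open>n\<close>. This is the divisibility argument in the
  Gaussian integers written out in coordinates.
\<close>

lemma lattice_pts_mult_norm:
  fixes x y :: int
  assumes p: "prime p" and xy: "int p = x\<^sup>2 + y\<^sup>2"
    and cd: "(c, d) \<in> lattice_pts (p * n)" and dvd: "int p dvd d * x - c * y"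
  shows "(c, d) \<in> (\<lambda>(a, b). (a * x - b * y, a * y + b * x)) ` lattice_pts n"
proof -
  have p0: "p > 0"
    using p prime_gt_0_nat by blast
  have eq: "c\<^sup>2 + d\<^sup>2 = int p * int n"
    using cd by (simp add: lattice_pts_def)
  obtain b where b: "d * x - c * y = int p * b"
    using dvd by (elim dvdE)
  have "(c * x + d * y)\<^sup>2 + (d * x - c * y)\<^sup>2 = (c\<^sup>2 + d\<^sup>2) * (x\<^sup>2 + y\<^sup>2)"
    by (simp add: power2_eq_square algebra_simps)
  hence norm: "(c * x + d * y)\<^sup>2 + (int p * b)\<^sup>2 = int p * (int p * int n)"
    unfolding eq b xy[symmetric] by simp
  have "int p dvd (c * x + d * y)\<^sup>2 + (int p * b)\<^sup>2"
    unfolding norm by simp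
  moreover have "int p dvd (int p * b)\<^sup>2"
    by (simp add: power2_eq_square)
  ultimately have "int p dvd (c * x + d * y)\<^sup>2"
    using dvd_add_left_iff by blast
  moreover have "prime (int p)"
    using p by simp
  ultimately have "int p dvd c * x + d * y"
    using prime_dvd_power by blast
  then obtain a where a: "c * x + d * y = int p * a"
    by (elim dvdE)
  have "int p * (int p * (a\<^sup>2 + b\<^sup>2)) = int p * (int p * int n)"
    using norm unfolding a by (simp add: power2_eq_square algebra_simps)
  hence "(a, b) \<in> lattice_pts n"
    using p0 by (simp add: lattice_pts_def)
  moreover have "int p * c = int p * (a * x - b * y)"
  proof -
    have "(x\<^sup>2 + y\<^sup>2) * c = (c * x + d * y) * x - (d * x - c * y) * y"
      by (simp add: power2_eq_square algebra_simps)
    thus ?thesis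
      unfolding a b xy[symmetric] by (simp add: algebra_simps)
  qed
  moreover have "int p * d = int p * (a * y + b * x)"
  proof -
    have "(x\<^sup>2 + y\<^sup>2) * d = (c * x + d * y) * y + (d * x - c * y) * x"
      by (simp add: power2_eq_square algebra_simps)
    thus ?thesis
      unfolding a b xy[symmetric] by (simp add: algebra_simps)
  qed
  ultimately show ?thesis
    using p0 by force
qed

text \<open>
  The points of norm \<open>p n\<close> are the multiples of \<open>x + i y\<close> and those of \<open>x - i y\<close> by points of
  norm \<open>n\<close>. Every point is of one of these kinds, because \<open>p\<close> divides the product of the two
  imaginary parts that decide this; a point of both kinds would have both coordinates divisible by
  \<open>p\<close>, hence \<open>p\<^sup>2\<close> would divide \<open>p n\<close>.
\<close>

lemma num_lattice_pts_mult_prime: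
  fixes x y :: int
  assumes p: "prime p" "odd p" and xy: "int p = x\<^sup>2 + y\<^sup>2" and n: "\<not> p dvd n"
  shows "num_lattice_pts (p * n) = 2 * num_lattice_pts n"
proof -
  (* f y and f (- y) are the multiplications by x + i y and x - i y *)
  define f :: "int \<Rightarrow> int \<times> int \<Rightarrow> int \<times> int"
    where "f = (\<lambda>w (a, b). (a * x - b * w, a * w + b * x))"
  have p0: "p > 0"
    using p prime_gt_0_nat by blast
  have prime: "prime (int p)"
    using p by simp
  have not_dvd_xy: "\<not> (int p dvd x \<or> int p dvd y)"
  proof
    assume "int p dvd x \<or> int p dvd y"
    moreover have "int p dvd x\<^sup>2 + y\<^sup>2"
      using xy by simp
    ultimately have "int p dvd x \<and> int p dvd y"
      using prime by (metis dvd_add_left_iff dvd_add_right_iff prime_dvd_power dvd_mult power2_eq_square)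
    then have "(int p)\<^sup>2 dvd x\<^sup>2 + y\<^sup>2"
      by (simp add: dvd_add dvd_power_same)
    then have "int p * int p dvd int p * 1"
      using xy by (simp add: power2_eq_square)
    then have "int p dvd 1"
      using p0 by (subst (asm) dvd_mult_cancel_left) auto
    thus False
      using prime not_prime_unit by blast
  qed
  have inj: "inj_on (f w) A" if w: "w\<^sup>2 = y\<^sup>2" for w A
  proof (rule inj_onI, clarify)
    fix a b c d assume "f w (a, b) = f w (c, d)"
    hence *: "a * x - b * w = c * x - d * w" "a * w + b * x = c * w + d * x"
      by (auto simp: f_def)
    (* multiplication by the conjugate inverts the map up to the factor p *)
    have "(x\<^sup>2 + w\<^sup>2) * a = (a * x - b * w) * x + (a * w + b * x) * w"
         "(x\<^sup>2 + w\<^sup>2) * b = (a * w + b * x) * x - (a * x - b * w) * w"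
         "(x\<^sup>2 + w\<^sup>2) * c = (c * x - d * w) * x + (c * w + d * x) * w"
         "(x\<^sup>2 + w\<^sup>2) * d = (c * w + d * x) * x - (c * x - d * w) * w"
      by (simp_all add: power2_eq_square algebra_simps)
    hence "(x\<^sup>2 + w\<^sup>2) * a = (x\<^sup>2 + w\<^sup>2) * c" "(x\<^sup>2 + w\<^sup>2) * b = (x\<^sup>2 + w\<^sup>2) * d"
      using * by simp_all
    moreover have "x\<^sup>2 + w\<^sup>2 \<noteq> 0"
      unfolding w xy[symmetric] using p0 by simp
    ultimately show "a = c \<and> b = d"
      by (simp only: mult_cancel_left) simp
  qed
  have sub: "f w ` lattice_pts n \<subseteq> lattice_pts (p * n)" if w: "w\<^sup>2 = y\<^sup>2" for w
  proof (rule image_subsetI)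
    fix l assume "l \<in> lattice_pts n"
    moreover obtain a b where "l = (a, b)"
      by (cases l)
    moreover have "(a * x - b * w)\<^sup>2 + (a * w + b * x)\<^sup>2 = (x\<^sup>2 + w\<^sup>2) * (a\<^sup>2 + b\<^sup>2)"
      by (simp add: power2_eq_square algebra_simps)
    ultimately show "f w l \<in> lattice_pts (p * n)"
      using xy w by (simp add: lattice_pts_def f_def)
  qed
  have cover: "lattice_pts (p * n) \<subseteq> f y ` lattice_pts n \<union> f (- y) ` lattice_pts n"
  proof (rule subrelI)
    fix c d assume cd: "(c, d) \<in> lattice_pts (p * n)"
    have "(d * x - c * y) * (d * x + c * y) = d\<^sup>2 * (x\<^sup>2 + y\<^sup>2) - y\<^sup>2 * (c\<^sup>2 + d\<^sup>2)"
      by (simp add: power2_eq_square algebra_simps)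
    also have "\<dots> = int p * (d\<^sup>2 - y\<^sup>2 * int n)"
      using cd by (simp add: lattice_pts_def algebra_simps flip: xy)
    finally have "int p dvd (d * x - c * y) * (d * x + c * y)"
      by simp
    hence "int p dvd d * x - c * y \<or> int p dvd d * x + c * y"
      using prime prime_dvd_mult_iff by blast
    thus "(c, d) \<in> f y ` lattice_pts n \<union> f (- y) ` lattice_pts n"
    proof
      assume "int p dvd d * x - c * y"
      thus ?thesis
        using lattice_pts_mult_norm[OF p(1) xy cd] by (simp add: f_def)
    next
      assume "int p dvd d * x + c * y"
      thus ?thesis
        using lattice_pts_mult_norm[OF p(1) _ cd, of x "- y"] xy by (simp add: f_def)
    qed
  qed
  have disj: "f y ` lattice_pts n \<inter> f (- y) ` lattice_pts n = {}"
  proof (rule ccontr)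
    assume "f y ` lattice_pts n \<inter> f (- y) ` lattice_pts n \<noteq> {}"
    then obtain l l' where l: "l \<in> lattice_pts n" "l' \<in> lattice_pts n" "f y l = f (- y) l'"
      by blast
    moreover obtain a b c d where "l = (a, b)" "l' = (c, d)"
      by (cases l, cases l')
    ultimately have cd: "(c, d) \<in> lattice_pts n" and eq: "f y (a, b) = f (- y) (c, d)"
      by auto
    (* u + i v is the point that has both kinds of representation *)
    define u v where "u = c * x + d * y" and "v = d * x - c * y"
    have uv: "a * x - b * y = u" "a * y + b * x = v"
      using eq by (auto simp: f_def u_def v_def algebra_simps)
    have "u * x + v * y = (x\<^sup>2 + y\<^sup>2) * a"
      unfolding uv[symmetric] by (simp add: power2_eq_square algebra_simps)
    moreover have "u * x - v * y = (x\<^sup>2 + y\<^sup>2) * c"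
      unfolding u_def v_def by (simp add: power2_eq_square algebra_simps)
    ultimately have "2 * u * x = (x\<^sup>2 + y\<^sup>2) * (a + c)" "2 * v * y = (x\<^sup>2 + y\<^sup>2) * (a - c)"
      unfolding distrib_left right_diff_distrib by linarith+
    hence "int p dvd 2 * u * x" "int p dvd 2 * v * y"
      unfolding xy[symmetric] by simp_all
    moreover have "\<not> int p dvd 2"
    proof
      assume "int p dvd 2"
      hence "p \<le> 2"
        by (auto dest: zdvd_imp_le)
      thus False
        using p prime_ge_2_nat[OF p(1)] by force
    qed
    ultimately have "int p dvd u" "int p dvd v"
      using prime not_dvd_xy by (auto simp: prime_dvd_mult_iff)
    hence "(int p)\<^sup>2 dvd u\<^sup>2 + v\<^sup>2"
      by (simp add: dvd_add dvd_power_same)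
    also have "u\<^sup>2 + v\<^sup>2 = (x\<^sup>2 + y\<^sup>2) * (c\<^sup>2 + d\<^sup>2)"
      unfolding u_def v_def by (simp add: power2_eq_square algebra_simps)
    also have "\<dots> = int p * int n"
      using cd xy by (simp add: lattice_pts_def)
    finally have "p dvd n"
      using p0 by (simp add: power2_eq_square)
    thus False
      using n by simp
  qed
  have "lattice_pts (p * n) = f y ` lattice_pts n \<union> f (- y) ` lattice_pts n"
    by (intro equalityI cover Un_least sub) auto
  thus ?thesis
    by (simp add: num_lattice_pts_def card_Un_disjoint disj finite_lattice_pts card_image inj)
qed


lemma split_primes_mult:
  assumes "a \<noteq> 0" "b \<noteq> 0"
  shows "split_primes (a * b) = split_primes a \<union> split_primes b"
  using assms by (auto simp: split_primes_def prime_factors_product)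

lemma split_primes_prime:
  assumes "prime p"
  shows "split_primes p = (if p mod 4 = 1 then {p} else {})"
  using assms by (auto simp: split_primes_def prime_prime_factors)

lemma finite_split_primes: "finite (split_primes n)"
  by (simp add: split_primes_def)

lemma simple_split_part_factor:
  assumes "simple_split_part (a * b)" "a \<noteq> 0" "b \<noteq> 0"
  shows "simple_split_part b"
  unfolding simple_split_part_def
proof
  fix p assume p: "p \<in> split_primes b"
  hence "prime p" "p dvd b"
    by (auto simp: split_primes_def)
  hence "multiplicity p b > 0"
    using assms by (simp add: prime_multiplicity_gt_zero_iff)
  moreover have "multiplicity p (a * b) = 1"
    using p assms by (auto simp: simple_split_part_def split_primes_mult)
  moreover have "multiplicity p (a * b) = multiplicity p a + multiplicity p b"
    using \<open>prime p\<close> assms by (intro prime_elem_multiplicity_mult_distrib) auto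
  ultimately show "multiplicity p b = 1"
    by simp
qed

lemma num_lattice_pts_pos_iff: "num_lattice_pts n > 0 \<longleftrightarrow> lattice_pts n \<noteq> {}"
  by (auto simp: num_lattice_pts_def card_gt_0_iff finite_lattice_pts)

text \<open>
  Induction on \<open>n\<close>, removing any one prime factor: 2 and \<open>q\<^sup>2\<close> with \<open>q \<equiv> 3 (mod 4)\<close> leave both sides
  unchanged, and a prime \<open>p \<equiv> 1 (mod 4)\<close>, which cannot divide the cofactor again, doubles both.
  The existence of a lattice point, needed for the cofactor as well, follows from the equality or
  doubling of the counts. The primes \<open>p \<equiv> 1 (mod 4)\<close> are taken to be sums of two squares by
  hypothesis, as a Gaussian prime above \<open>p\<close> is a representation of this kind.
\<close>

lemma num_lattice_pts_simple_split_part: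
  assumes "n > 0" "lattice_pts n \<noteq> {}" "simple_split_part n"
    and "\<And>p. p \<in> split_primes n \<Longrightarrow> \<exists>x y :: int. int p = x\<^sup>2 + y\<^sup>2"
  shows "num_lattice_pts n = 4 * 2 ^ card (split_primes n)"
  using assms
proof (induction n rule: less_induct)
  case (less n)
  show ?case
  proof (cases "n = 1")
    case True
    thus ?thesis
      using num_lattice_pts_1 by (simp add: split_primes_def)
  next
    case False
    then obtain p where p: "prime p" "p dvd n"
      using prime_factor_nat by blast
    have p1: "p > 1"
      using p prime_gt_1_nat by blast
    have IH: "num_lattice_pts m = 4 * 2 ^ card (split_primes m)"
      if "n = a * m" "a > 1" "num_lattice_pts m > 0" for a m
    proof (rule less.IH)
      have "m > 0"
        using that less.prems(1) by simp
      thus "m < n" "m > 0" "simple_split_part m"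
        using that less.prems(3) simple_split_part_factor[of a m] by auto
      show "lattice_pts m \<noteq> {}"
        using that num_lattice_pts_pos_iff by simp
      show "\<exists>x y :: int. int r = x\<^sup>2 + y\<^sup>2" if "r \<in> split_primes m" for r
        using less.prems(4)[of r] that \<open>n = a * m\<close> \<open>a > 1\<close> \<open>m > 0\<close> by (simp add: split_primes_mult)
    qed
    have num: "num_lattice_pts n > 0"
      using less.prems(2) num_lattice_pts_pos_iff by simp
    have "p = 2 \<or> odd p"
      using p primes_dvd_imp_eq two_is_prime_nat by blast
    hence "p = 2 \<or> p mod 4 = 1 \<or> p mod 4 = 3"
      by presburger
    then consider "p = 2" | "p mod 4 = 1" | "p mod 4 = 3"
      by blast
    thus ?thesis
    proof cases
      case 1
      obtain m where m: "n = 2 * m"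
        using p 1 by (auto elim: dvdE)
      have "split_primes n = split_primes m"
        using less.prems(1) split_primes_prime[of 2] by (simp add: m split_primes_mult)
      thus ?thesis
        using IH[OF m] num by (simp add: m num_lattice_pts_double)
    next
      case 2
      obtain m where m: "n = p * m"
        using p by (auto elim: dvdE)
      have m0: "m > 0"
        using m less.prems(1) by simp
      have split: "split_primes n = insert p (split_primes m)"
        using m0 p 2 p1 by (simp add: m split_primes_mult split_primes_prime)
      have "multiplicity p (p * m) = 1"
        using less.prems(3) split m by (simp add: simple_split_part_def)
      moreover have "multiplicity p (p * m) = multiplicity p p + multiplicity p m"
        using p m0 by (intro prime_elem_multiplicity_mult_distrib) auto
      moreover have "multiplicity p p = 1"
        using p by simp
      ultimately have "multiplicity p m = 0"
        by simp
      hence ndvd: "\<not> p dvd m"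
        using p m0 prime_multiplicity_gt_zero_iff[of p m] by simp
      hence "p \<notin> split_primes m"
        by (auto simp: split_primes_def)
      hence card: "card (split_primes n) = Suc (card (split_primes m))"
        by (simp add: split finite_split_primes)
      have "odd p"
        using 2 by presburger
      moreover obtain x y :: int where "int p = x\<^sup>2 + y\<^sup>2"
        using less.prems(4) split by blast
      ultimately have "num_lattice_pts n = 2 * num_lattice_pts m"
        unfolding m using num_lattice_pts_mult_prime[OF p(1)] ndvd by blast
      thus ?thesis
        using IH[OF m p1] num card by simp
    next
      case 3
      obtain m where m: "n = p\<^sup>2 * m"
        using square_dvd_of_lattice_pts[OF p(1) 3 less.prems(2) p(2)] by (elim dvdE)
      have "split_primes n = split_primes m"
        using less.prems(1) p1 p 3
        by (simp add: m split_primes_mult split_primes_prime power2_eq_square)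
      moreover have "p\<^sup>2 > 1"
        using p1 by (intro one_less_power) auto
      ultimately show ?thesis
        using IH[OF m] num p 3 by (simp add: m num_lattice_pts_3_mod_4)
    qed
  qed
qed


section \<open>The covariance at integer times\<close>

text \<open>
  The real part of \<open>\<Prod>\<^sub>p (cis (x p) + cis (- x p))\<close>, expanded in two ways.
\<close>

lemma sum_signs_cos:
  fixes x :: "'a \<Rightarrow> real"
  assumes "finite A"
  shows "(\<Sum>\<eta> \<in> A \<rightarrow>\<^sub>E {-1, 1}. cos (\<Sum>p\<in>A. \<eta> p * x p)) = 2 ^ card A * (\<Prod>p\<in>A. cos (x p))"
proof -
  have cis_sum: "(\<Prod>p\<in>A. cis (y p)) = cis (\<Sum>p\<in>A. y p)" for y :: "'a \<Rightarrow> real"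
    using assms by (induction A rule: finite_induct) (auto simp: cis_mult)
  have "(\<Sum>\<eta> \<in> A \<rightarrow>\<^sub>E {-1, 1}. cos (\<Sum>p\<in>A. \<eta> p * x p)) =
        Re (\<Sum>\<eta> \<in> A \<rightarrow>\<^sub>E {-1, 1}. \<Prod>p\<in>A. cis (\<eta> p * x p))"
    by (simp add: cis_sum)
  also have "\<dots> = Re (\<Prod>p\<in>A. \<Sum>s\<in>{-1, 1}. cis (s * x p))"
    using assms by (subst prod_sum_PiE) auto
  also have "(\<lambda>p. \<Sum>s\<in>{-1, 1}. cis (s * x p)) = (\<lambda>p. complex_of_real (2 * cos (x p)))"
    by (auto simp: complex_eq_iff)
  also have "Re (\<Prod>p\<in>A. complex_of_real (2 * cos (x p))) = (\<Prod>p\<in>A. 2 * cos (x p))"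
    by (metis Re_complex_of_real of_real_prod)
  also have "\<dots> = 2 ^ card A * (\<Prod>p\<in>A. cos (x p))"
    by (simp add: prod.distrib)
  finally show ?thesis .
qed

text \<open>
  The fractional part in \<^const>\<open>signed_angle\<close> changes the argument of the cosine by \<open>2 \<pi> t\<close> times an
  integer, which is a multiple of the period only because \<open>t\<close> is an integer.
\<close>

lemma lin_cov_of_int:
  assumes "num_lattice_pts n = 4 * 2 ^ card (split_primes n)"
  shows "lin_cov Q n (of_int t) = (\<Prod>p\<in>split_primes n. cos (2 * pi * (of_int t * turn_arg (Q p))))"
proof -
  have "cos (2 * pi * signed_angle Q n \<eta> * of_int t) =
        cos (\<Sum>p\<in>split_primes n. \<eta> p * (2 * pi * (of_int t * turn_arg (Q p))))" for \<eta>
  proof -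
    define a where "a = (\<Sum>p\<in>split_primes n. \<eta> p * turn_arg (Q p))"
    have "2 * pi * signed_angle Q n \<eta> * of_int t =
          2 * pi * a * of_int t - 2 * pi * of_int (\<lfloor>a\<rfloor> * t)"
      unfolding signed_angle_def a_def[symmetric] frac_def by (simp add: algebra_simps)
    hence "cos (2 * pi * signed_angle Q n \<eta> * of_int t) = cos (2 * pi * a * of_int t)"
      by (simp only: cos_diff cos_int_2pin sin_int_2pin mult_1_right mult_zero_right add_0_right)
    also have "2 * pi * a * of_int t = (\<Sum>p\<in>split_primes n. \<eta> p * (2 * pi * (of_int t * turn_arg (Q p))))"
      unfolding a_def sum_distrib_left sum_distrib_right by (intro sum.cong) auto
    finally show ?thesis .
  qed
  thus ?thesis
    by (simp add: lin_cov_def assms sum_signs_cos finite_split_primes)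
qed

lemma one_minus_cos_le:
  fixes x :: real
  shows "1 - cos x \<le> x\<^sup>2 / 2"
proof -
  have "1 - cos x = 2 * (sin (x / 2))\<^sup>2"
    using cos_double_sin[of "x / 2"] by simp
  also have "(sin (x / 2))\<^sup>2 \<le> (x / 2)\<^sup>2"
    using abs_sin_x_le_abs_x by (simp only: abs_le_square_iff)
  finally show ?thesis
    by (simp add: power2_eq_square)
qed

lemma Dirichlet_approx_finite:
  fixes \<theta> :: "'a \<Rightarrow> real"
  assumes "finite A" "N > 0"
  obtains t :: int where "1 \<le> t" "t \<le> int N ^ card A"
    "\<And>a. a \<in> A \<Longrightarrow> \<exists>m :: int. \<bar>of_int t * \<theta> a - of_int m\<bar> < 1 / real N"
proof -
  obtain h where h: "bij_betw h {0..<card A} A"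
    using ex_bij_betw_nat_finite[OF assms(1)] by blast
  obtain t m where t: "0 < t" "t \<le> int (N ^ card A)"
    and m: "\<And>i. i < card A \<Longrightarrow> \<bar>of_int t * \<theta> (h i) - of_int (m i)\<bar> < 1 / real N"
    using Dirichlet_approx_simult[OF assms(2), of "card A" "\<lambda>i. \<theta> (h i)"] by metis
  have "\<exists>k :: int. \<bar>of_int t * \<theta> a - of_int k\<bar> < 1 / real N" if "a \<in> A" for a
  proof -
    obtain i where "i < card A" "h i = a"
      using h \<open>a \<in> A\<close> by (metis atLeastLessThan_iff bij_betw_iff_bijections)
    thus ?thesis
      using m by blast
  qed
  thus ?thesis
    using t by (intro that[of t]) auto
qed

text \<open>
  All factors of the product lie in \<open>[-1, 1]\<close>, so its distance from 1 is at most the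
  sum of the distances \<open>1 - cos (2 \<pi> t \<theta>\<^sub>p) \<le> 2 \<pi>\<^sup>2 / N\<^sup>2\<close> of the factors.
\<close>

lemma lin_cov_near_1:
  assumes "num_lattice_pts n = 4 * 2 ^ card (split_primes n)" and "N > 0"
  obtains t :: int where "1 \<le> t" "t \<le> int N ^ card (split_primes n)"
    "\<bar>lin_cov Q n (of_int t) - 1\<bar> \<le> 2 * pi\<^sup>2 * real (card (split_primes n)) / (real N)\<^sup>2"
proof -
  obtain t :: int where t: "1 \<le> t" "t \<le> int N ^ card (split_primes n)"
    and approx: "\<And>p. p \<in> split_primes n \<Longrightarrow>
      \<exists>m :: int. \<bar>of_int t * turn_arg (Q p) - of_int m\<bar> < 1 / real N"
    using Dirichlet_approx_finite[OF finite_split_primes \<open>N > 0\<close>, of n "\<lambda>p. turn_arg (Q p)"] by blast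
  let ?c = "\<lambda>p. cos (2 * pi * (of_int t * turn_arg (Q p)))"
  have term_le: "\<bar>?c p - 1\<bar> \<le> 2 * pi\<^sup>2 / (real N)\<^sup>2" if p: "p \<in> split_primes n" for p
  proof -
    obtain m :: int where m: "\<bar>of_int t * turn_arg (Q p) - of_int m\<bar> < 1 / real N"
      using approx[OF p] by blast
    define d where "d = of_int t * turn_arg (Q p) - of_int m"
    have "2 * pi * (of_int t * turn_arg (Q p)) = 2 * pi * d + 2 * pi * of_int m"
      by (simp add: d_def algebra_simps)
    hence "?c p = cos (2 * pi * d)"
      by (simp add: cos_add)
    hence "\<bar>?c p - 1\<bar> = 1 - cos (2 * pi * d)"
      by simp
    also have "\<dots> \<le> (2 * pi * d)\<^sup>2 / 2"
      by (rule one_minus_cos_le)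
    also have "\<dots> = 2 * pi\<^sup>2 * \<bar>d\<bar>\<^sup>2"
      by (simp add: power_mult_distrib)
    also have "\<dots> \<le> 2 * pi\<^sup>2 * (1 / real N)\<^sup>2"
      using m by (intro mult_left_mono power_mono) (auto simp: d_def)
    finally show ?thesis
      by (simp add: power_divide)
  qed
  have "\<bar>lin_cov Q n (of_int t) - 1\<bar> = norm ((\<Prod>p\<in>split_primes n. ?c p) - (\<Prod>p\<in>split_primes n. 1))"
    by (simp add: lin_cov_of_int assms(1))
  also have "\<dots> \<le> (\<Sum>p\<in>split_primes n. norm (?c p - 1))"
    by (intro norm_prod_diff) auto
  also have "\<dots> \<le> (\<Sum>p\<in>split_primes n. 2 * pi\<^sup>2 / (real N)\<^sup>2)"
    using term_le by (intro sum_mono) simp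
  also have "\<dots> = 2 * pi\<^sup>2 * real (card (split_primes n)) / (real N)\<^sup>2"
    by simp
  finally show ?thesis
    using that t by blast
qed


section \<open>The size of the approximating time\<close>

lemma sums_two_squares_iff: "n \<in> sums_two_squares \<longleftrightarrow> lattice_pts n \<noteq> {}"
proof -
  have "n \<in> sums_two_squares \<longleftrightarrow> (\<exists>a b :: int. a\<^sup>2 + b\<^sup>2 = int n)"
    unfolding sums_two_squares_def by (simp add: eq_commute)
  thus ?thesis
    by (auto simp: lattice_pts_def)
qed

lemma gaussian_prime_choice_sum_squares:
  assumes "gaussian_prime_choice S P" "n \<in> S" "p \<in> split_primes n"
  obtains x y :: int where "int p = x\<^sup>2 + y\<^sup>2"
proof -
  have gp: "gaussian_prime (P n p)" and norm: "P n p * cnj (P n p) = of_nat p"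
    using assms by (auto simp: gaussian_prime_choice_def)
  obtain x y :: int where xy: "Re (P n p) = of_int x" "Im (P n p) = of_int y"
    using gp by (auto simp: gaussian_prime_def gaussian_ints_def elim!: Ints_cases)
  have "Re (P n p * cnj (P n p)) = real p"
    unfolding norm by simp
  hence "real_of_int (x\<^sup>2 + y\<^sup>2) = real_of_int (int p)"
    by (simp add: xy power2_eq_square)
  hence "int p = x\<^sup>2 + y\<^sup>2"
    by (simp only: of_int_eq_iff)
  thus ?thesis
    using that by blast
qed

lemma at_top_in_le: "at_top_in A \<le> at_top"
  by (simp add: at_top_in_def)

lemma at_top_in_mono: "A \<subseteq> B \<Longrightarrow> at_top_in A \<le> at_top_in B"
  unfolding at_top_in_def by (intro inf_mono order_refl) simp

lemma eventually_at_top_in_mem: "\<forall>\<^sub>F n in at_top_in A. n \<in> A"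
  by (simp add: at_top_in_def eventually_inf_principal)

text \<open>
  The true order of \<open>k\<close> is \<open>L / 2\<close> with \<open>L = log log n\<close>, from \<open>4 \<cdot> 2^k = \<N>\<^sub>n\<close>. The bound \<open>k \<le> L\<close>, with the
  leading constant given away, uses the typical size of \<open>\<N>\<^sub>n\<close> only through
  \<open>\<N>\<^sub>n \<le> (log n) powr log 2\<close>.
\<close>

lemma eventually_card_split_primes_le:
  assumes typical: "typical_lattice_count S" and le: "F \<le> at_top_in S"
    and num: "\<forall>\<^sub>F n in F. num_lattice_pts n = 4 * 2 ^ card (split_primes n)"
  shows "\<forall>\<^sub>F n in F. real (card (split_primes n)) \<le> ln (ln (real n))"
proof -
  obtain \<epsilon> :: "nat \<Rightarrow> real" where \<epsilon>: "(\<epsilon> \<longlongrightarrow> 0) (at_top_in S)"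
    and count: "\<forall>\<^sub>F n in at_top_in S. real (num_lattice_pts n) = ln (real n) powr (ln 2 / 2 + \<epsilon> n)"
    using typical unfolding typical_lattice_count_def by blast
  have "\<forall>\<^sub>F n in at_top_in S. \<epsilon> n < ln 2 / 2"
    using \<epsilon> by (rule order_tendstoD) simp
  moreover have "\<forall>\<^sub>F n::nat in at_top. ln (real n) > 1"
    by real_asymp
  hence "\<forall>\<^sub>F n in at_top_in S. ln (real n) > 1"
    by (rule filter_leD[OF at_top_in_le])
  ultimately have
    "\<forall>\<^sub>F n in at_top_in S. ln (real n) > 1 \<and> real (num_lattice_pts n) \<le> ln (real n) powr ln 2"
    using count
  proof eventually_elim
    case (elim n)
    have "ln 2 / 2 + \<epsilon> n \<le> ln 2"
      using elim(1) by simp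
    thus ?case
      using elim(2,3) by (simp add: powr_mono)
  qed
  hence "\<forall>\<^sub>F n in F. ln (real n) > 1 \<and> real (num_lattice_pts n) \<le> ln (real n) powr ln 2"
    by (rule filter_leD[OF le])
  with num show ?thesis
  proof eventually_elim
    case (elim n)
    have "2 powr real (card (split_primes n)) \<le> real (num_lattice_pts n)"
      using elim(1) by (simp add: powr_realpow)
    also have "\<dots> \<le> ln (real n) powr ln 2"
      using elim(2) by simp
    also have "\<dots> = 2 powr ln (ln (real n))"
      using elim(2) by (simp add: powr_def)
    finally show ?case
      by simp
  qed
qed

theorem proposition2p7:
  fixes S' :: "nat set" and P :: "nat \<Rightarrow> nat \<Rightarrow> complex"
  assumes "relative_density_one S' sums_two_squares"
    and "typical_lattice_count S'"
    and "equidistributed_lattice_pts S'"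
    and "gaussian_prime_choice S' P"
  shows "\<exists>c :: real. c > 0 \<and> ( \<exists>\<tau> :: nat \<Rightarrow> real.
    (\<forall>\<^sub>F n in at_top_in {n \<in> S'. simple_split_part n}.
       1 \<le> \<tau> n \<and> \<tau> n \<le> c * real (num_lattice_pts n) powr ln (ln (ln (real n)))) \<and>
    ((\<lambda>n. \<bar>lin_cov (P n) n (\<tau> n) - 1\<bar>) \<longlongrightarrow> 0) (at_top_in {n \<in> S'. simple_split_part n}))"
proof -
  define F where "F = at_top_in {n \<in> S'. simple_split_part n}"
  define L where "L = (\<lambda>n::nat. ln (ln (real n)))"
  define k where "k = (\<lambda>n. card (split_primes n))"
  define N where "N = (\<lambda>n. nat \<lfloor>L n powr ln 2\<rfloor>)"
  have F_S': "F \<le> at_top_in S'"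
    unfolding F_def by (intro at_top_in_mono) auto
  have F_top: "F \<le> at_top"
    unfolding F_def by (rule at_top_in_le)

  have "\<forall>\<^sub>F n in F. n \<in> S' \<and> simple_split_part n"
    using eventually_at_top_in_mem[of "{n \<in> S'. simple_split_part n}"] by (simp add: F_def)
  moreover have "\<forall>\<^sub>F n in F. n > 0"
    by (rule filter_leD[OF F_top eventually_gt_at_top])
  ultimately have num: "\<forall>\<^sub>F n in F. num_lattice_pts n = 4 * 2 ^ k n"
  proof eventually_elim
    case (elim n)
    show ?case
      unfolding k_def
    proof (rule num_lattice_pts_simple_split_part)
      show "lattice_pts n \<noteq> {}"
        using elim assms(1) sums_two_squares_iff by (auto simp: relative_density_one_def)
      show "\<exists>x y :: int. int p = x\<^sup>2 + y\<^sup>2" if "p \<in> split_primes n" for p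
        using gaussian_prime_choice_sum_squares[OF assms(4) _ that] elim by blast
    qed (use elim in auto)
  qed
  have k_le: "\<forall>\<^sub>F n in F. real (k n) \<le> L n"
    using eventually_card_split_primes_le[OF assms(2) F_S'] num by (simp add: k_def L_def)
  have "\<forall>\<^sub>F n in at_top. L n > 1"
    unfolding L_def by real_asymp
  hence L_gt: "\<forall>\<^sub>F n in F. L n > 1"
    by (rule filter_leD[OF F_top])

  define good where "good = (\<lambda>n (t::int). 1 \<le> t \<and> t \<le> int (N n) ^ k n \<and>
    \<bar>lin_cov (P n) n (of_int t) - 1\<bar> \<le> 2 * pi\<^sup>2 * real (k n) / (real (N n))\<^sup>2)"
  define t where "t = (\<lambda>n. SOME t. good n t)"
  have good: "\<forall>\<^sub>F n in F. good n (t n)"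
    using num L_gt
  proof eventually_elim
    case (elim n)
    have "1 \<le> L n powr ln 2"
      using elim by (intro ge_one_powr_ge_zero) auto
    hence "N n > 0"
      by (simp add: N_def)
    then obtain t' where "good n t'"
      using lin_cov_near_1[of n "N n" "P n"] elim(1) unfolding good_def k_def by metis
    thus ?case
      unfolding t_def by (rule someI)
  qed

  have bounds: "\<forall>\<^sub>F n in F. 1 \<le> real_of_int (t n) \<and>
      real_of_int (t n) \<le> 1 * real (num_lattice_pts n) powr ln (ln (ln (real n)))"
    using good num L_gt
  proof eventually_elim
    case (elim n)
    have "t n \<le> int (N n) ^ k n"
      using elim(1) by (simp add: good_def)
    hence "real_of_int (t n) \<le> real_of_int (int (N n) ^ k n)"
      by (simp only: of_int_le_iff)
    also have "\<dots> = real (N n) ^ k n"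
      by simp
    also have "\<dots> \<le> (L n powr ln 2) ^ k n"
      by (intro power_mono) (auto simp: N_def)
    also have "\<dots> = (2 ^ k n) powr ln (L n)"
      using elim(3) by (simp add: powr_def ln_realpow exp_of_nat_mult[symmetric] mult_ac)
    also have "\<dots> \<le> real (num_lattice_pts n) powr ln (L n)"
      using elim(2,3) by (intro powr_mono2) auto
    finally show ?case
      using elim(1) by (simp add: good_def L_def)
  qed

  have error: "\<forall>\<^sub>F n in F. \<bar>lin_cov (P n) n (of_int (t n)) - 1\<bar> \<le> 2 * pi\<^sup>2 * L n / (L n powr (2 / 3) - 1)\<^sup>2"
    using good k_le L_gt
  proof eventually_elim
    case (elim n)
    have pos: "L n powr (2 / 3) - 1 > 0"
      using elim(3) by simp
    (* the exponent log 2 may be lowered to 2/3, as L / N^2 tends to 0 for any exponent above 1/2 *)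
    have "L n powr (2 / 3) \<le> L n powr ln 2"
      using elim(3) ln2_ge_two_thirds by (intro powr_mono) auto
    also have "\<dots> - 1 \<le> real (N n)"
      unfolding N_def by linarith
    finally have N_ge: "L n powr (2 / 3) - 1 \<le> real (N n)"
      by simp
    have "\<bar>lin_cov (P n) n (of_int (t n)) - 1\<bar> \<le> 2 * pi\<^sup>2 * real (k n) / (real (N n))\<^sup>2"
      using elim(1) by (simp add: good_def)
    also have "\<dots> \<le> 2 * pi\<^sup>2 * L n / (L n powr (2 / 3) - 1)\<^sup>2"
      using elim(2) pos N_ge by (intro frac_le mult_left_mono power_mono) auto
    finally show ?case .
  qed
  have "((\<lambda>n. 2 * pi\<^sup>2 * L n / (L n powr (2 / 3) - 1)\<^sup>2) \<longlongrightarrow> 0) at_top"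
    unfolding L_def by real_asymp
  hence error_lim: "((\<lambda>n. 2 * pi\<^sup>2 * L n / (L n powr (2 / 3) - 1)\<^sup>2) \<longlongrightarrow> 0) F"
    by (rule tendsto_mono[OF F_top])
  have lim: "((\<lambda>n. \<bar>lin_cov (P n) n (of_int (t n)) - 1\<bar>) \<longlongrightarrow> 0) F"
    by (rule tendsto_sandwich[OF _ error tendsto_const error_lim]) simp
  show ?thesis
  proof (intro exI conjI)
    show "(0::real) < 1"
      by simp
  qed (use bounds lim in \<open>simp_all only: F_def\<close>)
qed

end
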